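(* Let $H_1,H_2\in(0,1)$ and let $B^1_{H_1}$, $B^2_{H_2}$ be independent fractional Brownian motions with Hurst parameters $H_1$ and $H_2$. The density $$p(x,t)=2\int_0^\infty\frac{e^{-\frac{x^2}{2s^{2H_1}}}}{\sqrt{2\pi s^{2H_1}}}\,\frac{e^{-\frac{s^2}{2t^{2H_2}}}}{\sqrt{2\pi t^{2H_2}}}\,ds,\qquad x\in\mathbb{R},\ t>0,$$ of the iterated fractional Brownian motion $I^1_F(t)=B^1_{H_1}(|B^2_{H_2}(t)|)$ is a solution to the second-order partial differential equation $$(1+H_1H_2)\,t\,\frac{\partial p}{\partial t}+t^2\,\frac{\partial^2p}{\partial t^2}=H_1^2H_2^2\left\{2x\frac{\partial p}{\partial x}+x^2\frac{\partial^2p}{\partial x^2}\right\},\qquad x\in\mathbb{R},\ t>0.$$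
   Context: A fractional Brownian motion $B_H$ with Hurst parameter $H\in(0,1)$ is a centred Gaussian process with covariance $E\{B_H(s)B_H(t)\}=\frac12\left(|t|^{2H}+|s|^{2H}-|t-s|^{2H}\right)$.
   Formalization: The paths of B^1 are assumed continuous on [0,∞). At x=0 with H_1≥1/3, where the second x-derivative of p does not exist, the terms x p_x and x² p_xx are read as 0, their limit as x→0; the x-derivatives are asserted only for x≠0 or H_1<1/3. *)

theory Defs
  imports "HOL-Probability.Probability"
begin

(* Normal laws in the wide sense: the degenerate (constant) case has to be admitted, since
   fractional Brownian motion vanishes at time 0 and linear combinations may cancel. *)
definition gaussian_variable :: "'a measure \<Rightarrow> ('a \<Rightarrow> real) \<Rightarrow> bool" where
  "gaussian_variable M X \<longleftrightarrow> X \<in> borel_measurable M \<and>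
     (\<exists>\<mu> \<sigma>. 0 < \<sigma> \<and> distributed M lborel X (normal_density \<mu> \<sigma>) \<or> (AE \<omega> in M. X \<omega> = \<mu>))"

definition gaussian_process ::
    "'a measure \<Rightarrow> 't set \<Rightarrow> ('t \<Rightarrow> 'a \<Rightarrow> real) \<Rightarrow> bool" where
  "gaussian_process M T B \<longleftrightarrow> prob_space M \<and> (\<forall>t\<in>T. B t \<in> borel_measurable M) \<and>
     (\<forall>J a. finite J \<and> J \<subseteq> T \<longrightarrow> gaussian_variable M (\<lambda>\<omega>. \<Sum>t\<in>J. a t * B t \<omega>))"

definition centred_process ::
    "'a measure \<Rightarrow> 't set \<Rightarrow> ('t \<Rightarrow> 'a \<Rightarrow> real) \<Rightarrow> bool" where
  "centred_process M T B \<longleftrightarrow> (\<forall>t\<in>T. (\<integral>\<omega>. B t \<omega> \<partial>M) = 0)"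

definition fractional_brownian_motion ::
    "'a measure \<Rightarrow> real set \<Rightarrow> real \<Rightarrow> (real \<Rightarrow> 'a \<Rightarrow> real) \<Rightarrow> bool" where
  "fractional_brownian_motion M T H B \<longleftrightarrow>
     0 < H \<and> H < 1 \<and> gaussian_process M T B \<and> centred_process M T B \<and>
     (\<forall>s\<in>T. \<forall>t\<in>T. (\<integral>\<omega>. B s \<omega> * B t \<omega> \<partial>M) =
        1 / 2 * (\<bar>t\<bar> powr (2 * H) + \<bar>s\<bar> powr (2 * H) - \<bar>t - s\<bar> powr (2 * H)))"

(* Independence of whole processes, as random elements of the product space over T. *)
definition independent_processes ::
    "'a measure \<Rightarrow> 't set \<Rightarrow> ('t \<Rightarrow> 'a \<Rightarrow> real) \<Rightarrow> ('t \<Rightarrow> 'a \<Rightarrow> real) \<Rightarrow> bool" where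
  "independent_processes M T B C \<longleftrightarrow>
     prob_space.indep_var M
       (Pi\<^sub>M T (\<lambda>_. borel)) (\<lambda>\<omega>. \<lambda>t\<in>T. B t \<omega>)
       (Pi\<^sub>M T (\<lambda>_. borel)) (\<lambda>\<omega>. \<lambda>t\<in>T. C t \<omega>)"

(* The finite-dimensional laws of B alone do not determine the law of B at the random time
   \<bar>C t\<bar>, so statements about this process assume that the paths of B are continuous. *)
definition iterated_process ::
    "(real \<Rightarrow> 'a \<Rightarrow> real) \<Rightarrow> (real \<Rightarrow> 'a \<Rightarrow> real) \<Rightarrow> real \<Rightarrow> 'a \<Rightarrow> real" where
  "iterated_process B C t \<omega> = B \<bar>C t \<omega>\<bar> \<omega>"

definition iterated_fbm_density :: "real \<Rightarrow> real \<Rightarrow> real \<Rightarrow> real \<Rightarrow> real" where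
  "iterated_fbm_density H1 H2 x t = 2 * (LBINT s:{0<..}.
     exp (- (x\<^sup>2 / (2 * s powr (2 * H1)))) / sqrt (2 * pi * s powr (2 * H1)) *
     (exp (- (s\<^sup>2 / (2 * t powr (2 * H2)))) / sqrt (2 * pi * t powr (2 * H2))))"

(* The density is twice differentiable in x at x = 0 only when H1 < 1/3 (it behaves like
   a + b \<bar>x\<bar> powr (1 / H1 - 1) + c x^2 there, with a logarithm when H1 = 1/3). In general
   x p_x and x^2 p_xx extend continuously by 0 to x = 0; this is the sense of the differential
   equation at that point. *)
definition twice_differentiable_at :: "(real \<Rightarrow> real) \<Rightarrow> real \<Rightarrow> bool" where
  "twice_differentiable_at f a \<longleftrightarrow>
     (\<forall>\<^sub>F y in nhds a. f differentiable (at y)) \<and> deriv f differentiable (at a)"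

end

theory Submission imports Defs begin

text \<open>Given \<open>B2 t\<close>, the variable \<open>B1 \<bar>B2 t\<bar>\<close> is centred normal with standard deviation
  \<open>\<bar>B2 t\<bar> powr H1\<close>, so \<open>p x t\<close> is a mixture of centred normal densities. As \<open>B2 t\<close> has the law
  of \<open>t powr H2\<close> times a standard normal variable, the mixture is self-similar:
  \<open>p x t = t powr - a * \<phi> (x * t powr - a)\<close> with \<open>a = H1 * H2\<close>. On such functions the operator
  \<open>\<theta> = t \<partial>\<^sub>t\<close> acts as \<open>- a (1 + x \<partial>\<^sub>x)\<close>, and the differential equation is the identity
  \<open>\<theta> (\<theta> + a) = a\<^sup>2 (1 + x \<partial>\<^sub>x) x \<partial>\<^sub>x\<close>. What remains is the smoothness of \<open>\<phi>\<close>, by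
  differentiation under the integral: with \<open>g\<close> the normal density of deviation \<open>\<sigma>\<close>, the
  functions \<open>x g'\<close> and \<open>x\<^sup>2 g''\<close> are bounded by multiples of \<open>1 / \<sigma>\<close>, which is integrable as
  \<open>H1 < 1\<close>; at \<open>x = 0\<close> the bound \<open>\<bar>g''\<bar> \<le> 3 / \<sigma> ^ 3\<close> is used, which is integrable if
  \<open>H1 < 1 / 3\<close>.\<close>

subsection \<open>Limits and derivatives of integrals\<close>

text \<open>By the mean value inequality on the ball, every difference quotient at \<open>x\<close>
  is bounded by the same \<open>w\<close> that bounds the derivatives \<open>f' y\<close>. Dominated
  convergence along sequences tending to \<open>x\<close> then moves the limit inside the
  integral.\<close>

lemma has_real_derivative_lebesgue_integral:
  fixes f f' :: "real \<Rightarrow> 'a \<Rightarrow> real"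
  assumes e: "0 < e"
    and int: "\<And>y. dist x y < e \<Longrightarrow> integrable M (f y)"
    and der: "\<And>y \<omega>. dist x y < e \<Longrightarrow> \<omega> \<in> space M \<Longrightarrow>
      ((\<lambda>y. f y \<omega>) has_real_derivative f' y \<omega>) (at y)"
    and meas: "f' x \<in> borel_measurable M"
    and bound: "\<And>y \<omega>. dist x y < e \<Longrightarrow> \<omega> \<in> space M \<Longrightarrow> \<bar>f' y \<omega>\<bar> \<le> w \<omega>"
    and w: "integrable M w"
  shows "((\<lambda>y. \<integral>\<omega>. f y \<omega> \<partial>M) has_real_derivative (\<integral>\<omega>. f' x \<omega> \<partial>M)) (at x)"
proof -
  let ?q = "\<lambda>y \<omega>. (f y \<omega> - f x \<omega>) / (y - x)"
  have "((\<lambda>y. ((\<integral>\<omega>. f y \<omega> \<partial>M) - (\<integral>\<omega>. f x \<omega> \<partial>M)) / (y - x)) \<longlongrightarrow> (\<integral>\<omega>. f' x \<omega> \<partial>M))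
      (at x within ball x e)"
    unfolding tendsto_at_iff_sequentially
  proof safe
    fix X :: "nat \<Rightarrow> real"
    assume X: "\<forall>i. X i \<in> ball x e - {x}" and lim: "X \<longlonglongrightarrow> x"
    have Xe: "dist x (X i) < e" "X i \<noteq> x" for i
      using X by auto
    have "(\<lambda>i. \<integral>\<omega>. ?q (X i) \<omega> \<partial>M) \<longlonglongrightarrow> (\<integral>\<omega>. f' x \<omega> \<partial>M)"
    proof (rule integral_dominated_convergence[OF meas _ w])
      show "?q (X i) \<in> borel_measurable M" for i
        using int[OF Xe(1)[of i]] int[of x] e by (auto intro!: borel_measurable_divide borel_measurable_diff)
      show "AE \<omega> in M. (\<lambda>i. ?q (X i) \<omega>) \<longlonglongrightarrow> f' x \<omega>"
      proof (rule AE_I2)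
        fix \<omega> assume "\<omega> \<in> space M"
        then have "((\<lambda>y. ?q y \<omega>) \<longlongrightarrow> f' x \<omega>) (at x)"
          using der[of x \<omega>] e by (simp add: has_field_derivative_iff)
        then show "(\<lambda>i. ?q (X i) \<omega>) \<longlonglongrightarrow> f' x \<omega>"
          unfolding tendsto_at_iff_sequentially comp_def using Xe(2) lim by auto
      qed
      show "AE \<omega> in M. norm (?q (X i) \<omega>) \<le> w \<omega>" for i
      proof (rule AE_I2)
        fix \<omega> assume \<omega>: "\<omega> \<in> space M"
        have "norm (f (X i) \<omega> - f x \<omega>) \<le> w \<omega> * norm (X i - x)"
        proof (rule field_differentiable_bound[of "ball x e" "\<lambda>y. f y \<omega>" "\<lambda>y. f' y \<omega>"])
          show "((\<lambda>y. f y \<omega>) has_field_derivative f' y \<omega>) (at y within ball x e)"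
            if "y \<in> ball x e" for y
            using der[of y \<omega>] that \<omega> by (auto intro: has_field_derivative_at_within)
        qed (use bound \<omega> Xe e in auto)
        then show "norm (?q (X i) \<omega>) \<le> w \<omega>"
          using Xe(2)[of i] by (simp add: divide_simps)
      qed
    qed
    moreover have "(\<integral>\<omega>. ?q (X i) \<omega> \<partial>M) = ((\<integral>\<omega>. f (X i) \<omega> \<partial>M) - (\<integral>\<omega>. f x \<omega> \<partial>M)) / (X i - x)" for i
      using Bochner_Integration.integral_diff[OF int[OF Xe(1)[of i]] int[of x]] e by simp
    ultimately show "((\<lambda>y. ((\<integral>\<omega>. f y \<omega> \<partial>M) - (\<integral>\<omega>. f x \<omega> \<partial>M)) / (y - x)) \<circ> X)
        \<longlonglongrightarrow> (\<integral>\<omega>. f' x \<omega> \<partial>M)"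
      by (simp only: comp_def)
  qed
  then show ?thesis
    using e by (simp add: has_field_derivative_iff at_within_open[of x "ball x e"])
qed

lemma tendsto_at_lebesgue_integral:
  fixes f :: "real \<Rightarrow> 'a \<Rightarrow> real"
  assumes meas: "\<And>y. f y \<in> borel_measurable M" "g \<in> borel_measurable M"
    and lim: "\<And>\<omega>. \<omega> \<in> space M \<Longrightarrow> ((\<lambda>y. f y \<omega>) \<longlongrightarrow> g \<omega>) (at x)"
    and bound: "\<And>y \<omega>. \<omega> \<in> space M \<Longrightarrow> \<bar>f y \<omega>\<bar> \<le> w \<omega>"
    and w: "integrable M w"
  shows "((\<lambda>y. \<integral>\<omega>. f y \<omega> \<partial>M) \<longlongrightarrow> (\<integral>\<omega>. g \<omega> \<partial>M)) (at x)"
  unfolding tendsto_at_iff_sequentially comp_def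
proof (intro allI impI)
  fix X :: "nat \<Rightarrow> real"
  assume X: "\<forall>i. X i \<in> UNIV - {x}" "X \<longlonglongrightarrow> x"
  show "(\<lambda>i. \<integral>\<omega>. f (X i) \<omega> \<partial>M) \<longlonglongrightarrow> (\<integral>\<omega>. g \<omega> \<partial>M)"
    using lim[unfolded tendsto_at_iff_sequentially comp_def] X
    by (intro integral_dominated_convergence[OF meas(2) meas(1) w]) (auto simp: bound)
qed

subsection \<open>Scale mixtures of normal densities\<close>

text \<open>In this section \<open>\<sigma> = 0\<close> needs no special treatment: \<open>normal_density 0 0\<close>, its formal
  derivatives and all bounds by powers of \<open>1 / \<bar>\<sigma>\<bar>\<close> are then \<open>0\<close>.\<close>

definition normal_density_deriv :: "real \<Rightarrow> real \<Rightarrow> real" where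
  "normal_density_deriv \<sigma> x = - x / \<sigma>\<^sup>2 * normal_density 0 \<sigma> x"

definition normal_density_deriv2 :: "real \<Rightarrow> real \<Rightarrow> real" where
  "normal_density_deriv2 \<sigma> x = (x\<^sup>2 / \<sigma> ^ 4 - 1 / \<sigma>\<^sup>2) * normal_density 0 \<sigma> x"

lemma has_real_derivative_normal_density:
  "((\<lambda>x. normal_density 0 \<sigma> x) has_real_derivative normal_density_deriv \<sigma> x) (at x)"
proof (cases "\<sigma> = 0")
  case False
  then show ?thesis
    unfolding normal_density_def normal_density_deriv_def
    by (auto intro!: derivative_eq_intros simp: field_simps)
qed (simp add: normal_density_def normal_density_deriv_def)

lemma has_real_derivative_normal_density_deriv:
  "((\<lambda>x. normal_density_deriv \<sigma> x) has_real_derivative normal_density_deriv2 \<sigma> x) (at x)"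
proof (cases "\<sigma> = 0")
  case False
  then show ?thesis
    unfolding normal_density_deriv_def normal_density_deriv2_def
    by (auto intro!: derivative_eq_intros has_real_derivative_normal_density 
        simp: normal_density_deriv_def field_simps power2_eq_square power4_eq_xxxx)
qed (simp add: normal_density_deriv_def normal_density_deriv2_def)

section \<open>Bounds on the normal density and its derivatives, uniform in the argument\<close>

lemma normal_density_le:
  "normal_density 0 \<sigma> x \<le> exp (- (x\<^sup>2 / \<sigma>\<^sup>2) / 2) / \<bar>\<sigma>\<bar>"
proof (cases "\<sigma> = 0")
  case False
  have "1 \<le> sqrt (2 * pi)" using pi_ge_two by simp
  then have "\<bar>\<sigma>\<bar> * 1 \<le> \<bar>\<sigma>\<bar> * sqrt (2 * pi)"
    by (intro mult_left_mono) auto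
  also have "\<bar>\<sigma>\<bar> * sqrt (2 * pi) = sqrt (2 * pi * \<sigma>\<^sup>2)"
    by (simp add: real_sqrt_mult)
  finally have "1 / sqrt (2 * pi * \<sigma>\<^sup>2) \<le> 1 / \<bar>\<sigma>\<bar>"
    using False by (intro divide_left_mono) (auto intro!: mult_pos_pos)
  then have "1 / sqrt (2 * pi * \<sigma>\<^sup>2) * exp (- (x\<^sup>2 / \<sigma>\<^sup>2) / 2) \<le> 1 / \<bar>\<sigma>\<bar> * exp (- (x\<^sup>2 / \<sigma>\<^sup>2) / 2)"
    by (intro mult_right_mono) auto
  then show ?thesis by (simp add: normal_density_def mult.commute)
qed (simp add: normal_density_def)

text \<open>The estimate 1 + z/2 + z^2/8 \<le> exp (z/2) bounds z and z^2 by multiples of exp (z/2).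
  The square root is reduced to the first two bounds by sqrt z \<le> 1 + z, whence the constant 3 =
  1 + 2.\<close>

lemma power_exp_bounds:
  fixes z :: real
  assumes "0 \<le> z"
  shows "exp (- z / 2) \<le> 1" "z * exp (- z / 2) \<le> 2" "z\<^sup>2 * exp (- z / 2) \<le> 8"
    "sqrt z * exp (- z / 2) \<le> 3"
proof -
  show 1: "exp (- z / 2) \<le> 1" using assms by simp
  have e: "1 + z / 2 + (z / 2)\<^sup>2 / 2 \<le> exp (z / 2)"
    using exp_lower_Taylor_quadratic[of "z / 2"] assms by simp
  have le: "exp (z / 2) * exp (- z / 2) = 1"
    by (simp add: exp_minus)
  have "z \<le> 2 * exp (z / 2)" using e assms by (smt (verit) zero_le_power2 field_sum_of_halves)
  then have "z * exp (- z / 2) \<le> 2 * exp (z / 2) * exp (- z / 2)"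
    by (rule mult_right_mono) simp
  then show 2: "z * exp (- z / 2) \<le> 2" by (simp only: mult.assoc le mult_1_right)
  have "z\<^sup>2 \<le> 8 * exp (z / 2)" using e assms by (simp add: power_divide)
  then have "z\<^sup>2 * exp (- z / 2) \<le> 8 * exp (z / 2) * exp (- z / 2)"
    by (rule mult_right_mono) simp
  then show "z\<^sup>2 * exp (- z / 2) \<le> 8" by (simp only: mult.assoc le mult_1_right)
  have "sqrt z \<le> 1 + z" using assms
    by (intro real_le_lsqrt) (auto simp: power2_eq_square algebra_simps)
  then have "sqrt z * exp (- z / 2) \<le> (1 + z) * exp (- z / 2)"
    by (rule mult_right_mono) simp
  also have "\<dots> = exp (- z / 2) + z * exp (- z / 2)" by (simp add: distrib_right)
  finally show "sqrt z * exp (- z / 2) \<le> 3" using 1 2 by linarith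
qed

text \<open>Write g for the density and z for x^2/\<sigma>^2. Then x g' = - z g, x^2 g'' = (z^2 - z)
  g, |g'| = sqrt z g / |\<sigma>| and g'' = (z - 1) g / \<sigma>^2. Each polynomial factor in z is
  absorbed by exp (- z/2), which leaves a power of 1/|\<sigma>|. The constants 10 = 8 + 2 and 3 = 2
  + 1 come from bounding a difference of nonnegative terms by the sum of their bounds.\<close>

lemma normal_density_bounds:
  fixes \<sigma> x :: real
  shows "normal_density 0 \<sigma> x \<le> 1 / \<bar>\<sigma>\<bar>"
    "\<bar>x * normal_density_deriv \<sigma> x\<bar> \<le> 2 / \<bar>\<sigma>\<bar>"
    "\<bar>x\<^sup>2 * normal_density_deriv2 \<sigma> x\<bar> \<le> 10 / \<bar>\<sigma>\<bar>"
    "\<bar>normal_density_deriv \<sigma> x\<bar> \<le> 3 / \<sigma>\<^sup>2"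
    "\<bar>normal_density_deriv2 \<sigma> x\<bar> \<le> 3 / \<bar>\<sigma>\<bar> ^ 3"
proof -
  let ?z = "x\<^sup>2 / \<sigma>\<^sup>2"
  let ?g = "normal_density 0 \<sigma> x"
  have z: "0 \<le> ?z" by simp
  have diff: "\<bar>a - b\<bar> \<le> c + d" if "0 \<le> a" "0 \<le> b" "a \<le> c" "b \<le> d" for a b c d :: real
    using that by linarith
  have g: "c * ?g \<le> (c * exp (- ?z / 2)) / \<bar>\<sigma>\<bar>" if "0 \<le> c" for c
    using mult_left_mono[OF normal_density_le that] by simp
  have b: "c * ?g \<le> d / \<bar>\<sigma>\<bar>" if "0 \<le> c" "c * exp (- ?z / 2) \<le> d" for c d
    using g[OF that(1)] divide_right_mono[OF that(2), of "\<bar>\<sigma>\<bar>"] by simp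
  note B = power_exp_bounds[OF z]
  show "?g \<le> 1 / \<bar>\<sigma>\<bar>" using b[of 1 1] B(1) by simp
  have "\<bar>x * normal_density_deriv \<sigma> x\<bar> = ?z * ?g"
    by (simp add: normal_density_deriv_def abs_mult power2_eq_square)
  then show "\<bar>x * normal_density_deriv \<sigma> x\<bar> \<le> 2 / \<bar>\<sigma>\<bar>" using b[OF z B(2)] by simp
  have "x\<^sup>2 * normal_density_deriv2 \<sigma> x = ?z\<^sup>2 * ?g - ?z * ?g"
    by (simp add: normal_density_deriv2_def power_divide algebra_simps power2_eq_square power4_eq_xxxx)
  moreover have "?z\<^sup>2 * ?g \<le> 8 / \<bar>\<sigma>\<bar>" "?z * ?g \<le> 2 / \<bar>\<sigma>\<bar>"
    using b[OF _ B(3)] b[OF z B(2)] by simp_all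
  moreover have "10 / \<bar>\<sigma>\<bar> = 8 / \<bar>\<sigma>\<bar> + 2 / \<bar>\<sigma>\<bar>"
    by (simp add: add_divide_distrib[symmetric])
  ultimately show "\<bar>x\<^sup>2 * normal_density_deriv2 \<sigma> x\<bar> \<le> 10 / \<bar>\<sigma>\<bar>"
    using diff by (simp only: z zero_le_power2 zero_le_mult_iff normal_density_nonneg simp_thms)
  have "\<bar>normal_density_deriv \<sigma> x\<bar> = (sqrt ?z * ?g) / \<bar>\<sigma>\<bar>"
    by (simp add: normal_density_deriv_def abs_mult power2_eq_square real_sqrt_divide)
  also have "\<dots> \<le> (3 / \<bar>\<sigma>\<bar>) / \<bar>\<sigma>\<bar>"
    using b[OF _ B(4)] by (intro divide_right_mono) auto
  finally show "\<bar>normal_density_deriv \<sigma> x\<bar> \<le> 3 / \<sigma>\<^sup>2" by (simp add: power2_eq_square)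
  have eq: "normal_density_deriv2 \<sigma> x = (?z * ?g) / \<sigma>\<^sup>2 - ?g / \<sigma>\<^sup>2"
    by (simp add: normal_density_deriv2_def algebra_simps power2_eq_square power4_eq_xxxx)
  have le: "(?z * ?g) / \<sigma>\<^sup>2 \<le> (2 / \<bar>\<sigma>\<bar>) / \<sigma>\<^sup>2" "?g / \<sigma>\<^sup>2 \<le> (1 / \<bar>\<sigma>\<bar>) / \<sigma>\<^sup>2"
    using b[OF z B(2)] b[of 1 1] B(1) by (intro divide_right_mono; simp)+
  have sum: "3 / \<bar>\<sigma>\<bar> ^ 3 = (2 / \<bar>\<sigma>\<bar>) / \<sigma>\<^sup>2 + (1 / \<bar>\<sigma>\<bar>) / \<sigma>\<^sup>2"
    by (simp add: power3_eq_cube power2_eq_square add_divide_distrib[symmetric])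
  show "\<bar>normal_density_deriv2 \<sigma> x\<bar> \<le> 3 / \<bar>\<sigma>\<bar> ^ 3"
    unfolding eq sum by (rule diff[OF _ _ le]) simp_all
qed

text \<open>Since \<open>deriv f\<close> coincides with \<open>f'\<close> on a neighbourhood of
  \<open>a\<close>, the two have the same derivative at \<open>a\<close>.\<close>

lemma twice_differentiable_atI:
  assumes f: "\<forall>\<^sub>F y in nhds a. (f has_real_derivative f' y) (at y)"
    and f': "(f' has_real_derivative D) (at a)"
  shows "twice_differentiable_at f a" "deriv f a = f' a" "deriv (deriv f) a = D"
proof -
  have ev: "\<forall>\<^sub>F y in nhds a. deriv f y = f' y"
    using f by eventually_elim (rule DERIV_imp_deriv)
  then show "deriv f a = f' a" by (rule eventually_nhds_x_imp_x)
  have D: "(deriv f has_real_derivative D) (at a)"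
    using f' DERIV_cong_ev[OF refl ev refl] by simp
  then show "deriv (deriv f) a = D" by (rule DERIV_imp_deriv)
  have "\<forall>\<^sub>F y in nhds a. f differentiable (at y)"
    using f by eventually_elim (auto simp: real_differentiable_def)
  then show "twice_differentiable_at f a"
    using D unfolding twice_differentiable_at_def by (auto simp: real_differentiable_def)
qed

section \<open>Differentiability of normal scale mixtures and their behaviour at zero\<close>

text \<open>The first inverse moment of the scale dominates the density and, away from the origin,
  both of its derivatives. The third inverse moment, which serves at the origin, is left to the
  individual lemmas, because it is finite for some Hurst parameters only.\<close>

locale normal_scale_mixture =
  fixes M :: "'a measure" and \<sigma> :: "'a \<Rightarrow> real"
  assumes measurable_scale[measurable]: "\<sigma> \<in> borel_measurable M"
    and integrable_inverse_scale: "integrable M (\<lambda>\<omega>. 1 / \<bar>\<sigma> \<omega>\<bar>)"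
begin

definition mixture :: "real \<Rightarrow> real" where
  "mixture x = (\<integral>\<omega>. normal_density 0 (\<sigma> \<omega>) x \<partial>M)"

definition mixture_deriv :: "real \<Rightarrow> real" where
  "mixture_deriv x = (\<integral>\<omega>. normal_density_deriv (\<sigma> \<omega>) x \<partial>M)"

definition mixture_deriv2 :: "real \<Rightarrow> real" where
  "mixture_deriv2 x = (\<integral>\<omega>. normal_density_deriv2 (\<sigma> \<omega>) x \<partial>M)"

lemma measurable_normal_densities[measurable]:
  "(\<lambda>\<omega>. normal_density 0 (\<sigma> \<omega>) x) \<in> borel_measurable M"
  "(\<lambda>\<omega>. normal_density_deriv (\<sigma> \<omega>) x) \<in> borel_measurable M"
  "(\<lambda>\<omega>. normal_density_deriv2 (\<sigma> \<omega>) x) \<in> borel_measurable M"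
  unfolding normal_density_deriv_def normal_density_deriv2_def normal_density_def by measurable

lemma integrable_normal_density_scale: "integrable M (\<lambda>\<omega>. normal_density 0 (\<sigma> \<omega>) x)"
  by (rule Bochner_Integration.integrable_bound[OF integrable_inverse_scale])
    (auto intro!: AE_I2 normal_density_bounds(1))

text \<open>A single \<open>w\<close> serves both derivatives near \<open>x\<close>. If
  \<open>x\<close> is nonzero, nearby points satisfy |y| \<ge> |x|/2, so the bounds on y g' and y^2
  g'' can be divided by a positive constant. At zero the bounds by inverse powers of |\<sigma>|
  alone are used.\<close>

lemma dominating_function:
  assumes "x \<noteq> 0 \<or> integrable M (\<lambda>\<omega>. 1 / \<bar>\<sigma> \<omega>\<bar> ^ 3)"
  obtains e w where "0 < e" "integrable M w"
    "\<And>y \<omega>. dist x y < e \<Longrightarrow> \<bar>normal_density_deriv (\<sigma> \<omega>) y\<bar> \<le> w \<omega>"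
    "\<And>y \<omega>. dist x y < e \<Longrightarrow> \<bar>normal_density_deriv2 (\<sigma> \<omega>) y\<bar> \<le> w \<omega>"
proof (cases "x = 0")
  case False
  define e where "e = \<bar>x\<bar> / 2"
  have e: "0 < e" using False by (simp add: e_def)
  define w where "w = (\<lambda>\<omega>. (2 / e + 10 / e\<^sup>2) * (1 / \<bar>\<sigma> \<omega>\<bar>))"
  show ?thesis
  proof (rule that[OF e, of w])
    show "integrable M w"
      unfolding w_def by (intro integrable_mult_right integrable_inverse_scale)
    fix y \<omega> assume "dist x y < e"
    then have y1: "e \<le> \<bar>y\<bar>" unfolding e_def dist_real_def by linarith
    then have y2: "e\<^sup>2 \<le> y\<^sup>2" using e abs_le_square_iff[THEN iffD1, of e y] by linarith
    have "e * \<bar>normal_density_deriv (\<sigma> \<omega>) y\<bar> \<le> \<bar>y * normal_density_deriv (\<sigma> \<omega>) y\<bar>"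
      using y1 by (simp add: abs_mult mult_right_mono)
    also have "\<dots> \<le> 2 / \<bar>\<sigma> \<omega>\<bar>" by (rule normal_density_bounds)
    finally have "e * \<bar>normal_density_deriv (\<sigma> \<omega>) y\<bar> / e \<le> (2 / \<bar>\<sigma> \<omega>\<bar>) / e"
      by (rule divide_right_mono) (use e in simp)
    then have "\<bar>normal_density_deriv (\<sigma> \<omega>) y\<bar> \<le> (2 / \<bar>\<sigma> \<omega>\<bar>) / e"
      using e by simp
    also have "\<dots> = 2 / e * (1 / \<bar>\<sigma> \<omega>\<bar>)" by simp
    also have "\<dots> \<le> w \<omega>" unfolding w_def by (rule mult_right_mono) auto
    finally show "\<bar>normal_density_deriv (\<sigma> \<omega>) y\<bar> \<le> w \<omega>" .
    have "e\<^sup>2 * \<bar>normal_density_deriv2 (\<sigma> \<omega>) y\<bar> \<le> \<bar>y\<^sup>2 * normal_density_deriv2 (\<sigma> \<omega>) y\<bar>"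
      using y2 by (simp add: abs_mult mult_right_mono)
    also have "\<dots> \<le> 10 / \<bar>\<sigma> \<omega>\<bar>" by (rule normal_density_bounds)
    finally have "e\<^sup>2 * \<bar>normal_density_deriv2 (\<sigma> \<omega>) y\<bar> / e\<^sup>2 \<le> (10 / \<bar>\<sigma> \<omega>\<bar>) / e\<^sup>2"
      by (rule divide_right_mono) (use e in simp)
    then have "\<bar>normal_density_deriv2 (\<sigma> \<omega>) y\<bar> \<le> (10 / \<bar>\<sigma> \<omega>\<bar>) / e\<^sup>2"
      using e by simp
    also have "\<dots> = 10 / e\<^sup>2 * (1 / \<bar>\<sigma> \<omega>\<bar>)" by simp
    also have "\<dots> \<le> w \<omega>" unfolding w_def using e by (intro mult_right_mono) auto
    finally show "\<bar>normal_density_deriv2 (\<sigma> \<omega>) y\<bar> \<le> w \<omega>" .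
  qed
next
  case True
  define w where "w = (\<lambda>\<omega>. 3 * (1 / \<bar>\<sigma> \<omega>\<bar> + 1 / \<bar>\<sigma> \<omega>\<bar> ^ 3))"
  \<comment> \<open>With r = 1/|\<sigma>|, this controls the second inverse power, which bounds the
    first derivative, by the first and third powers, whose integrability is available.\<close>
  have interpolate: "r\<^sup>2 \<le> r + r ^ 3" if "0 \<le> r" for r :: real
  proof -
    have "0 \<le> r * ((r - 1)\<^sup>2 + r)"
      using that by (intro mult_nonneg_nonneg add_nonneg_nonneg zero_le_power2)
    also have "\<dots> = r + r ^ 3 - r\<^sup>2" by (simp add: power2_eq_square power3_eq_cube algebra_simps)
    finally show ?thesis by simp
  qed
  show ?thesis
  \<comment> \<open>The bounds hold for every \<open>y\<close>, so any positive radius would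
    do.\<close>
  proof (rule that[of 1 w])
    show "integrable M w"
      unfolding w_def using integrable_inverse_scale assms True
      by (intro integrable_mult_right Bochner_Integration.integrable_add) simp_all
    fix y \<omega>
    have "\<bar>normal_density_deriv (\<sigma> \<omega>) y\<bar> \<le> 3 / (\<sigma> \<omega>)\<^sup>2" by (rule normal_density_bounds)
    also have "\<dots> \<le> w \<omega>"
    proof -
      have "3 / (\<sigma> \<omega>)\<^sup>2 = 3 * (1 / \<bar>\<sigma> \<omega>\<bar>)\<^sup>2" by (simp add: power_divide)
      also have "\<dots> \<le> 3 * (1 / \<bar>\<sigma> \<omega>\<bar> + (1 / \<bar>\<sigma> \<omega>\<bar>) ^ 3)"
        by (intro mult_left_mono interpolate) auto
      also have "\<dots> = w \<omega>" by (simp only: w_def power_one_over)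
      finally show ?thesis .
    qed
    finally show "\<bar>normal_density_deriv (\<sigma> \<omega>) y\<bar> \<le> w \<omega>" .
    have "\<bar>normal_density_deriv2 (\<sigma> \<omega>) y\<bar> \<le> 3 / \<bar>\<sigma> \<omega>\<bar> ^ 3" by (rule normal_density_bounds)
    also have "\<dots> \<le> w \<omega>" by (simp add: w_def)
    finally show "\<bar>normal_density_deriv2 (\<sigma> \<omega>) y\<bar> \<le> w \<omega>" .
  qed simp
qed

lemma has_real_derivative_mixture:
  assumes "x \<noteq> 0 \<or> integrable M (\<lambda>\<omega>. 1 / \<bar>\<sigma> \<omega>\<bar> ^ 3)"
  shows "(mixture has_real_derivative mixture_deriv x) (at x)"
    "(mixture_deriv has_real_derivative mixture_deriv2 x) (at x)"
proof -
  obtain e w where e: "0 < e" and w: "integrable M w"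
    and w1: "\<And>y \<omega>. dist x y < e \<Longrightarrow> \<bar>normal_density_deriv (\<sigma> \<omega>) y\<bar> \<le> w \<omega>"
    and w2: "\<And>y \<omega>. dist x y < e \<Longrightarrow> \<bar>normal_density_deriv2 (\<sigma> \<omega>) y\<bar> \<le> w \<omega>"
    using dominating_function[OF assms] by blast
  show "(mixture has_real_derivative mixture_deriv x) (at x)"
    unfolding mixture_def[abs_def] mixture_deriv_def
    by (rule has_real_derivative_lebesgue_integral[OF e integrable_normal_density_scale
          has_real_derivative_normal_density measurable_normal_densities(2) w1 w])
  \<comment> \<open>Differentiating a second time requires the first derivative to be integrable at
    all points near \<open>x\<close>; the same \<open>w\<close> provides this.\<close>
  have int: "integrable M (\<lambda>\<omega>. normal_density_deriv (\<sigma> \<omega>) y)" if "dist x y < e" for y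
    by (rule Bochner_Integration.integrable_bound[OF w])
      (use order_trans[OF w1[OF that] abs_ge_self] in auto)
  show "(mixture_deriv has_real_derivative mixture_deriv2 x) (at x)"
    unfolding mixture_deriv_def[abs_def] mixture_deriv2_def
    by (rule has_real_derivative_lebesgue_integral[OF e int
          has_real_derivative_normal_density_deriv measurable_normal_densities(3) w2 w])
qed

lemma mixture_derivs:
  assumes "x \<noteq> 0 \<or> integrable M (\<lambda>\<omega>. 1 / \<bar>\<sigma> \<omega>\<bar> ^ 3)"
  shows "twice_differentiable_at mixture x" "deriv mixture x = mixture_deriv x"
    "deriv (deriv mixture) x = mixture_deriv2 x"
proof -
  \<comment> \<open>The condition persists near \<open>x\<close>: being nonzero is an open
    condition, and the moment condition does not involve the point.\<close>
  have "\<forall>\<^sub>F y in nhds x. y \<noteq> 0 \<or> integrable M (\<lambda>\<omega>. 1 / \<bar>\<sigma> \<omega>\<bar> ^ 3)"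
  proof (cases "x = 0")
    case False
    then show ?thesis by (intro eventually_mono[OF t1_space_nhds]) auto
  qed (use assms in auto)
  then have "\<forall>\<^sub>F y in nhds x. (mixture has_real_derivative mixture_deriv y) (at y)"
    by eventually_elim (rule has_real_derivative_mixture)
  note * = twice_differentiable_atI[OF this has_real_derivative_mixture(2)[OF assms]]
  show "twice_differentiable_at mixture x" "deriv mixture x = mixture_deriv x"
    "deriv (deriv mixture) x = mixture_deriv2 x"
    by (fact *)+
qed

text \<open>The integrands x g' and x^2 g'' tend to 0 pointwise and are bounded by multiples of
  1/|\<sigma>| uniformly in x, so the first inverse moment suffices for dominated convergence. The
  limits are punctured, hence the integrals have to be identified with derivatives of the mixture
  only for nonzero x.\<close>

lemma mixture_limits:
  shows "((\<lambda>x. x * deriv mixture x) \<longlongrightarrow> 0) (at 0)"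
    "((\<lambda>x. x\<^sup>2 * deriv (deriv mixture) x) \<longlongrightarrow> 0) (at 0)"
proof -
  have ev: "\<forall>\<^sub>F x in at 0. x \<noteq> (0::real)" by (simp add: eventually_at_filter)
  have "((\<lambda>x. \<integral>\<omega>. x * normal_density_deriv (\<sigma> \<omega>) x \<partial>M) \<longlongrightarrow> (\<integral>\<omega>. 0 \<partial>M)) (at 0)"
  proof (rule tendsto_at_lebesgue_integral)
    show "integrable M (\<lambda>\<omega>. 2 * (1 / \<bar>\<sigma> \<omega>\<bar>))"
      by (intro integrable_mult_right integrable_inverse_scale)
    fix \<omega> x
    have "isCont (\<lambda>x. x * normal_density_deriv (\<sigma> \<omega>) x) 0"
      by (intro continuous_intros DERIV_isCont[OF has_real_derivative_normal_density_deriv])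
    then show "((\<lambda>x. x * normal_density_deriv (\<sigma> \<omega>) x) \<longlongrightarrow> 0) (at 0)"
      by (simp add: isCont_def)
    show "\<bar>x * normal_density_deriv (\<sigma> \<omega>) x\<bar> \<le> 2 * (1 / \<bar>\<sigma> \<omega>\<bar>)"
      using normal_density_bounds(2) by simp
  qed measurable
  moreover have "\<forall>\<^sub>F x in at 0. (\<integral>\<omega>. x * normal_density_deriv (\<sigma> \<omega>) x \<partial>M) = x * deriv mixture x"
    using ev by eventually_elim (simp add: mixture_derivs(2) mixture_deriv_def)
  ultimately have "((\<lambda>x. x * deriv mixture x) \<longlongrightarrow> (\<integral>\<omega>. 0 \<partial>M)) (at 0)"
    by (rule Lim_transform_eventually)
  then show "((\<lambda>x. x * deriv mixture x) \<longlongrightarrow> 0) (at 0)" by simp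
  have "((\<lambda>x. \<integral>\<omega>. x\<^sup>2 * normal_density_deriv2 (\<sigma> \<omega>) x \<partial>M) \<longlongrightarrow> (\<integral>\<omega>. 0 \<partial>M)) (at 0)"
  proof (rule tendsto_at_lebesgue_integral)
    show "integrable M (\<lambda>\<omega>. 10 * (1 / \<bar>\<sigma> \<omega>\<bar>))"
      by (intro integrable_mult_right integrable_inverse_scale)
    fix \<omega> x
    have "isCont (normal_density 0 (\<sigma> \<omega>)) 0"
      by (rule DERIV_isCont[OF has_real_derivative_normal_density])
    then have "isCont (\<lambda>x. x\<^sup>2 * normal_density_deriv2 (\<sigma> \<omega>) x) 0"
      unfolding normal_density_deriv2_def divide_inverse by (intro continuous_intros)
    then show "((\<lambda>x. x\<^sup>2 * normal_density_deriv2 (\<sigma> \<omega>) x) \<longlongrightarrow> 0) (at 0)"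
      by (simp add: isCont_def)
    show "\<bar>x\<^sup>2 * normal_density_deriv2 (\<sigma> \<omega>) x\<bar> \<le> 10 * (1 / \<bar>\<sigma> \<omega>\<bar>)"
      using normal_density_bounds(3) by simp
  qed measurable
  moreover have "\<forall>\<^sub>F x in at 0. (\<integral>\<omega>. x\<^sup>2 * normal_density_deriv2 (\<sigma> \<omega>) x \<partial>M) = x\<^sup>2 * deriv (deriv mixture) x"
    using ev by eventually_elim (simp add: mixture_derivs(3) mixture_deriv2_def)
  ultimately have "((\<lambda>x. x\<^sup>2 * deriv (deriv mixture) x) \<longlongrightarrow> (\<integral>\<omega>. 0 \<partial>M)) (at 0)"
    by (rule Lim_transform_eventually)
  then show "((\<lambda>x. x\<^sup>2 * deriv (deriv mixture) x) \<longlongrightarrow> 0) (at 0)" by simp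
qed

end

section \<open>Negative absolute moments of the standard normal law\<close>

text \<open>On [-1, 1] the density is at most 1 and the power is integrable since \<alpha> < 1;
  outside, the power is at most 1 and the density is integrable. The sum of the two majorants
  dominates everywhere.\<close>

lemma integrable_powr_std_normal_density:
  fixes \<alpha> :: real
  assumes \<alpha>: "0 \<le> \<alpha>" "\<alpha> < 1"
  shows "integrable lborel (\<lambda>u. std_normal_density u * \<bar>u\<bar> powr - \<alpha>)"
proof -
  let ?k = "\<lambda>u::real. indicator {-1..1} u * \<bar>u\<bar> powr - \<alpha> :: real"
  have "(\<lambda>u. u powr - \<alpha>) absolutely_integrable_on {0..1::real}"
    using \<alpha> by (intro nonnegative_absolutely_integrable_1 integrable_on_powr_from_0) auto
  then have "integrable lborel (\<lambda>u. indicator {0..1::real} u *\<^sub>R u powr - \<alpha>)"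
    unfolding set_integrable_def by (subst (asm) integrable_completion) auto
  also have "(\<lambda>u. indicator {0..1::real} u *\<^sub>R u powr - \<alpha>) = (\<lambda>u. indicator {0..} u *\<^sub>R ?k u)"
    by (auto simp: fun_eq_iff indicator_def)
  finally have half: "integrable lborel (\<lambda>u. indicator {0..} u *\<^sub>R ?k u)" .
  have even: "?k (- u) = ?k u" for u by (auto simp: indicator_def)
  have "integrable lborel ?k"
    by (rule integrable.intros[OF has_bochner_integral_even_function[OF has_bochner_integral_integrable[OF half] even]])
  then have "integrable lborel (\<lambda>u. ?k u + std_normal_density u)"
    by (intro Bochner_Integration.integrable_add) auto
  then show ?thesis
  proof (rule Bochner_Integration.integrable_bound)
    show "AE u in lborel. norm (std_normal_density u * \<bar>u\<bar> powr - \<alpha>) \<le> norm (?k u + std_normal_density u)"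
    proof (rule AE_I2)
      fix u :: real
      have "exp (- (u\<^sup>2 / 2)) / sqrt (2 * pi) \<le> 1 / 1"
        using pi_ge_two by (intro frac_le) auto
      then have n: "std_normal_density u \<le> 1" by (simp add: std_normal_density_def)
      show "norm (std_normal_density u * \<bar>u\<bar> powr - \<alpha>) \<le> norm (?k u + std_normal_density u)"
      proof (cases "u \<in> {-1..1}")
        case True
        have "std_normal_density u * \<bar>u\<bar> powr - \<alpha> \<le> 1 * \<bar>u\<bar> powr - \<alpha>"
          using n by (rule mult_right_mono) simp
        then show ?thesis using True normal_density_nonneg[of 0 1 u] by (simp add: abs_mult del: normal_density_nonneg)
      next
        case False
        then have "\<bar>u\<bar> powr - \<alpha> \<le> 1"
          using \<alpha> powr_mono[of "- \<alpha>" 0 "\<bar>u\<bar>"] by auto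
        then have "std_normal_density u * \<bar>u\<bar> powr - \<alpha> \<le> std_normal_density u * 1"
          by (rule mult_left_mono) simp
        then show ?thesis using False by (simp add: abs_mult)
      qed
    qed
  qed auto
qed

subsection \<open>Self-similar functions\<close>

text \<open>The profile \<phi> is differentiated away from 0 only. For nonzero \<open>x\<close> its
  argument never vanishes; for \<open>x = 0\<close> the function of time is a constant times a power
  of t, and the terms with derivatives of \<phi> carry a factor \<open>x\<close>.\<close>

lemma self_similar_pde:
  fixes p :: "real \<Rightarrow> real \<Rightarrow> real" and a x t :: real
  assumes p: "\<And>x t. 0 < t \<Longrightarrow> p x t = t powr - a * \<phi> (x * t powr - a)"
    and d1: "\<And>y. y \<noteq> 0 \<Longrightarrow> (\<phi> has_real_derivative \<phi>' y) (at y)"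
    and d2: "\<And>y. y \<noteq> 0 \<Longrightarrow> (\<phi>' has_real_derivative \<phi>'' y) (at y)"
    and t: "0 < t"
  shows "twice_differentiable_at (\<lambda>\<tau>. p x \<tau>) t"
    "(1 + a) * t * deriv (\<lambda>\<tau>. p x \<tau>) t + t\<^sup>2 * deriv (deriv (\<lambda>\<tau>. p x \<tau>)) t =
      a\<^sup>2 * (2 * x * deriv (\<lambda>\<xi>. p \<xi> t) x + x\<^sup>2 * deriv (deriv (\<lambda>\<xi>. p \<xi> t)) x)"
proof -
  define u where "u = (\<lambda>\<tau>::real. \<tau> powr - a)"
  have u_pos: "0 < u \<tau>" if "0 < \<tau>" for \<tau> using that by (simp add: u_def)
  define c where "c = (\<lambda>\<tau>. - a * u \<tau> / \<tau>)"
  have u: "(u has_real_derivative c \<tau>) (at \<tau>)" if "0 < \<tau>" for \<tau>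
    using has_real_derivative_powr[OF that, of "- a"] that unfolding u_def c_def
    by (simp add: powr_diff)
  have \<phi>: "((\<lambda>\<tau>. \<phi> (x * u \<tau>)) has_real_derivative \<phi>' (x * u \<tau>) * (x * c \<tau>)) (at \<tau>)"
    if "0 < \<tau>" for \<tau>
  proof (cases "x = 0")
    case False
    then have "x * u \<tau> \<noteq> 0" using u_pos[OF that] by simp
    then show ?thesis by (intro DERIV_chain2[OF d1] DERIV_cmult u that)
  qed simp
  \<comment> \<open>Keeping the factor \<open>x\<close> makes \<open>q\<close> the zero function
    when \<open>x = 0\<close>, so it is differentiable even where \<phi>' need not be.\<close>
  define q where "q = (\<lambda>\<tau>. x * \<phi>' (x * u \<tau>))"
  have q: "(q has_real_derivative
      x * (\<phi>'' (x * u \<tau>) * (x * c \<tau>))) (at \<tau>)" if "0 < \<tau>" for \<tau>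
  proof (cases "x = 0")
    case False
    then have "x * u \<tau> \<noteq> 0" using u_pos[OF that] by simp
    then show ?thesis unfolding q_def by (intro DERIV_cmult DERIV_chain2[OF d2] u that)
  qed (simp add: q_def)
  define p1 where "p1 = (\<lambda>\<tau>. - a / \<tau> * u \<tau> * (\<phi> (x * u \<tau>) + u \<tau> * q \<tau>))"
  \<comment> \<open>With y = x u and D = y d/dy, \<open>V\<close> is (1 + D) \<phi> and
    \<open>W\<close> is (1 + D)^2 \<phi>, both at y. The time derivatives become t p_t = - a u V and
    t^2 p_tt = a u V + a^2 u W, so the left-hand side of the equation collapses to a^2 u (W -
    V).\<close>
  define V W where "V = \<phi> (x * u t) + u t * (x * \<phi>' (x * u t))"
    and "W = \<phi> (x * u t) + 3 * x * u t * \<phi>' (x * u t) + x\<^sup>2 * (u t)\<^sup>2 * \<phi>'' (x * u t)"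
  define p2 where "p2 = (a * u t * V + a\<^sup>2 * u t * W) / t\<^sup>2"
  have pos: "\<forall>\<^sub>F \<tau> in nhds t. 0 < \<tau>"
    using t by (intro eventually_nhds_in_open[of "{0<..}", simplified]) auto
  have "((\<lambda>\<tau>. p x \<tau>) has_real_derivative p1 \<tau>) (at \<tau>)" if \<tau>: "0 < \<tau>" for \<tau>
  proof -
    have "((\<lambda>\<tau>. u \<tau> * \<phi> (x * u \<tau>)) has_real_derivative p1 \<tau>) (at \<tau>)"
      using \<tau> unfolding p1_def
      by (auto intro!: derivative_eq_intros u \<phi> simp: q_def c_def field_simps)
    moreover have ev: "\<forall>\<^sub>F s in nhds \<tau>. p x s = u s * \<phi> (x * u s)"
      using \<tau> by (intro eventually_mono[OF eventually_nhds_in_open[of "{0<..}"]]) (auto simp: p u_def)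
    ultimately show ?thesis using DERIV_cong_ev[OF refl ev refl] by simp
  qed
  then have ev: "\<forall>\<^sub>F \<tau> in nhds t. ((\<lambda>\<tau>. p x \<tau>) has_real_derivative p1 \<tau>) (at \<tau>)"
    using pos by (auto elim: eventually_mono)
  \<comment> \<open>This is u V as a function of time: the first derivative is - a r/\<tau>, and
    differentiating r applies 1 + D once more, which turns V into W.\<close>
  define r where "r = (\<lambda>\<tau>. u \<tau> * (\<phi> (x * u \<tau>) + u \<tau> * q \<tau>))"
  have r: "(r has_real_derivative c t * W) (at t)"
    unfolding r_def
    by (rule DERIV_cong[OF DERIV_mult[OF u[OF t] DERIV_add[OF \<phi>[OF t] DERIV_mult[OF u[OF t] q[OF t]]]]])
      (simp add: q_def W_def algebra_simps power2_eq_square)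
  have p1: "(p1 has_real_derivative p2) (at t)"
  proof -
    have "p1 = (\<lambda>\<tau>. - a * r \<tau> / \<tau>)"
      by (simp add: p1_def r_def fun_eq_iff)
    moreover have "((\<lambda>\<tau>. - a * r \<tau> / \<tau>) has_real_derivative
        ((- a * (c t * W)) * t - - a * r t * 1) / (t * t)) (at t)"
      using t by (intro DERIV_divide DERIV_cmult r DERIV_ident) simp
    moreover have "((- a * (c t * W)) * t - - a * r t * 1) / (t * t) = p2"
      using t by (simp add: p2_def c_def r_def q_def V_def power2_eq_square ac_simps)
    ultimately show ?thesis by simp
  qed
  note time = twice_differentiable_atI[OF ev p1]
  show "twice_differentiable_at (\<lambda>\<tau>. p x \<tau>) t" by (rule time)
  have lhs: "(1 + a) * t * deriv (\<lambda>\<tau>. p x \<tau>) t + t\<^sup>2 * deriv (deriv (\<lambda>\<tau>. p x \<tau>)) t =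
      a\<^sup>2 * u t * (2 * x * u t * \<phi>' (x * u t) + x\<^sup>2 * (u t)\<^sup>2 * \<phi>'' (x * u t))"
  proof -
    have "t\<^sup>2 * p2 = a * u t * V + a\<^sup>2 * u t * W" "t * p1 t = - a * u t * V"
      using t by (simp_all add: p2_def p1_def q_def V_def)
    then have "(1 + a) * (t * p1 t) + t\<^sup>2 * p2 = a\<^sup>2 * u t * (W - V)"
      by (simp add: algebra_simps power2_eq_square)
    also have "W - V = 2 * x * u t * \<phi>' (x * u t) + x\<^sup>2 * (u t)\<^sup>2 * \<phi>'' (x * u t)"
      by (simp add: V_def W_def)
    finally show ?thesis unfolding time by (simp only: mult.assoc)
  qed
  show "(1 + a) * t * deriv (\<lambda>\<tau>. p x \<tau>) t + t\<^sup>2 * deriv (deriv (\<lambda>\<tau>. p x \<tau>)) t =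
      a\<^sup>2 * (2 * x * deriv (\<lambda>\<xi>. p \<xi> t) x + x\<^sup>2 * deriv (deriv (\<lambda>\<xi>. p \<xi> t)) x)"
  proof (cases "x = 0")
    \<comment> \<open>Every term on either side has a factor \<open>x\<close>, whatever value
      \<open>deriv\<close> takes at 0.\<close>
    case True
    then show ?thesis unfolding lhs by simp
  next
    case False
    have pt: "p \<xi> t = u t * \<phi> (\<xi> * u t)" for \<xi> using p[OF t] by (simp add: u_def)
    have nz: "\<xi> * u t \<noteq> 0" if "\<xi> \<noteq> 0" for \<xi> using that u_pos[OF t] by simp
    have "((\<lambda>\<xi>. p \<xi> t) has_real_derivative (u t)\<^sup>2 * \<phi>' (\<xi> * u t)) (at \<xi>)" if "\<xi> \<noteq> 0" for \<xi>
      unfolding pt by (auto intro!: derivative_eq_intros DERIV_chain2[OF d1] nz that simp: power2_eq_square)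
    then have "\<forall>\<^sub>F \<xi> in nhds x. ((\<lambda>\<xi>. p \<xi> t) has_real_derivative (u t)\<^sup>2 * \<phi>' (\<xi> * u t)) (at \<xi>)"
      using False by (intro eventually_mono[OF t1_space_nhds]) auto
    moreover have "((\<lambda>\<xi>. (u t)\<^sup>2 * \<phi>' (\<xi> * u t)) has_real_derivative (u t) ^ 3 * \<phi>'' (x * u t)) (at x)"
      by (auto intro!: derivative_eq_intros DERIV_chain2[OF d2] nz False
          simp: power2_eq_square power3_eq_cube)
    ultimately show ?thesis
      unfolding lhs by (simp add: twice_differentiable_atI power2_eq_square power3_eq_cube algebra_simps)
  qed
qed

subsection \<open>Processes at independent random times\<close>

context prob_space
begin

text \<open>The random time is approximated by times with finitely many values, for which independence
  can be applied value by value; path continuity passes to the limit.\<close>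

lemma
  fixes X :: "real \<Rightarrow> 'a \<Rightarrow> real" and \<tau> :: "'a \<Rightarrow> real"
  assumes cont: "\<And>\<omega>. \<omega> \<in> space M \<Longrightarrow> continuous_on {0..} (\<lambda>s. X s \<omega>)"
    and indep: "\<And>s. 0 \<le> s \<Longrightarrow> indep_var borel (X s) borel \<tau>"
    and nonneg: "\<And>\<omega>. \<omega> \<in> space M \<Longrightarrow> 0 \<le> \<tau> \<omega>"
  shows borel_measurable_independent_time: "(\<lambda>\<omega>. X (\<tau> \<omega>) \<omega>) \<in> borel_measurable M"
    and integral_independent_time: "\<And>f :: real \<Rightarrow> complex. continuous_on UNIV f \<Longrightarrow> bounded (range f) \<Longrightarrow>
      (\<integral>\<omega>. f (X (\<tau> \<omega>) \<omega>) \<partial>M) = (\<integral>\<omega>. (\<integral>\<omega>'. f (X (\<tau> \<omega>) \<omega>') \<partial>M) \<partial>M)"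
proof -
  have X[measurable]: "X s \<in> borel_measurable M" if "0 \<le> s" for s
    using indep_var_rv1[OF indep[OF that]] .
  have \<tau>[measurable]: "\<tau> \<in> borel_measurable M"
    using indep_var_rv2[OF indep[of 0]] by simp
  obtain F :: "nat \<Rightarrow> real \<Rightarrow> real" where F: "\<And>i. simple_function borel (F i)"
    and F_lim: "\<And>s. (\<lambda>i. F i s) \<longlonglongrightarrow> s"
    using borel_measurable_implies_sequence_metric[of "\<lambda>s. s" borel 0] by auto
  \<comment> \<open>Absolute values keep the approximating times in the half-line on which paths are
    continuous; as \<open>\<tau>\<close> is nonnegative, the limit is unchanged.\<close>
  define d where "d i s = \<bar>F i s\<bar>" for i s
  have d: "0 \<le> d i s" "finite (range (d i))" "d i \<in> borel_measurable borel"
    for i s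
  proof -
    have "range (d i) = abs ` range (F i)" by (auto simp: d_def)
    then show "finite (range (d i))"
      using simple_functionD(1)[OF F[of i]] by simp
    show "d i \<in> borel_measurable borel"
      using borel_measurable_simple_function[OF F[of i]] unfolding d_def[abs_def] by measurable
  qed (simp add: d_def)
  have d_lim: "(\<lambda>i. d i (\<tau> \<omega>)) \<longlonglongrightarrow> \<tau> \<omega>" if "\<omega> \<in> space M" for \<omega>
    using tendsto_rabs[OF F_lim[of "\<tau> \<omega>"]] nonneg[OF that] by (simp add: d_def)
  have path_lim: "(\<lambda>i. X (s i) \<omega>) \<longlonglongrightarrow> X l \<omega>"
    if "s \<longlonglongrightarrow> l" "\<And>i. 0 \<le> s i" "0 \<le> l" "\<omega> \<in> space M" for s l \<omega>
    using continuous_on_tendsto_compose[OF cont[OF that(4)] that(1)] that(2,3) by simp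
  have X_step[measurable]: "(\<lambda>\<omega>. X (d i (\<tau> \<omega>)) \<omega>) \<in> borel_measurable M" for i
  proof (rule measurable_compose_countable'[where I = "range (d i)" and f = X and g = "\<lambda>\<omega>. d i (\<tau> \<omega>)"])
    show "countable (range (d i))" using d(2) by (rule countable_finite)
    show "(\<lambda>\<omega>. d i (\<tau> \<omega>)) \<in> measurable M (count_space (range (d i)))"
    proof (rule measurable_count_space_eq2[OF d(2), THEN iffD2], intro conjI ballI)
      fix v
      have "(\<lambda>\<omega>. d i (\<tau> \<omega>)) -` {v} \<inter> space M = {\<omega> \<in> space M. d i (\<tau> \<omega>) = v}" by auto
      also have "\<dots> \<in> sets M" using d(3)[of i] by measurable
      finally show "(\<lambda>\<omega>. d i (\<tau> \<omega>)) -` {v} \<inter> space M \<in> sets M" .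
    qed auto
  qed (auto simp: d(1))
  show "(\<lambda>\<omega>. X (\<tau> \<omega>) \<omega>) \<in> borel_measurable M"
    by (rule borel_measurable_LIMSEQ_metric[OF X_step]) (auto intro!: path_lim d_lim d(1) nonneg)
  note [measurable] = this
  fix f :: "real \<Rightarrow> complex"
  assume f: "continuous_on UNIV f" and "bounded (range f)"
  then obtain B where B: "\<And>x. norm (f x) \<le> B" unfolding bounded_iff by auto
  have [measurable]: "f \<in> borel_measurable borel"
    using f by (rule borel_measurable_continuous_onI)
  \<comment> \<open>The mean at a deterministic time. The claim is that the mean at the random time
    is the integral of \<open>h (\<tau> \<omega>)\<close>.\<close>
  define h where "h s = (\<integral>\<omega>. f (X s \<omega>) \<partial>M)" for s
  have f_lim: "(\<lambda>i. f (x i)) \<longlonglongrightarrow> f l" if "x \<longlonglongrightarrow> l" for x l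
    using continuous_on_tendsto_compose[OF f that] by simp
  have int: "integrable M (\<lambda>\<omega>. f (X s \<omega>))" if "0 \<le> s" for s
    using that by (intro integrable_const_bound[of _ B]) (auto simp: B)
  have h_lim: "(\<lambda>i. h (s i)) \<longlonglongrightarrow> h l" if "s \<longlonglongrightarrow> l" "\<And>i. 0 \<le> s i" "0 \<le> l" for s l
    unfolding h_def
    by (rule integral_dominated_convergence[where w = "\<lambda>_. B"])
      (use that in \<open>auto intro!: f_lim path_lim B\<close>)
  have B0: "0 \<le> B" using norm_ge_zero B order_trans by blast
  \<comment> \<open>The bound is wanted for all real \<open>s\<close>; where the integrand is not
    integrable, \<open>h s\<close> is 0 by default.\<close>
  have h_bound: "norm (h s) \<le> B" for s
  proof (cases "integrable M (\<lambda>\<omega>. f (X s \<omega>))")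
    case True
    have "norm (h s) \<le> (\<integral>\<omega>. norm (f (X s \<omega>)) \<partial>M)" unfolding h_def by (rule integral_norm_bound)
    also have "\<dots> \<le> (\<integral>\<omega>. B \<partial>M)" using True B by (intro integral_mono) auto
    finally show ?thesis by (simp add: prob_space)
  qed (simp add: h_def not_integrable_integral_eq B0)
  have h_step: "(\<lambda>\<omega>. h (d i (\<tau> \<omega>))) = (\<lambda>\<omega>. \<Sum>v\<in>range (d i). indicator {v} (d i (\<tau> \<omega>)) * h v)" for i
    using d(2)[of i] by (auto simp: fun_eq_iff indicator_def if_distrib sum.If_cases Int_absorb2 cong: if_cong)
  have [measurable]: "(\<lambda>\<omega>. h (d i (\<tau> \<omega>))) \<in> borel_measurable M" for i
    using d(3)[of i] unfolding h_step by measurable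
  have step: "(\<integral>\<omega>. f (X (d i (\<tau> \<omega>)) \<omega>) \<partial>M) = (\<integral>\<omega>. h (d i (\<tau> \<omega>)) \<partial>M)" for i
  proof -
    \<comment> \<open>On the event that the approximating time equals \<open>v\<close>, the process
      is read at the fixed time \<open>v\<close>. The indicator depends on \<open>\<tau>\<close>
      only, so independence factors the expectation and \<open>f (X v \<omega>)\<close> may be
      replaced by its mean.\<close>
    have ind: "(\<integral>\<omega>. indicator {v} (d i (\<tau> \<omega>)) * f (X v \<omega>) \<partial>M) = (\<integral>\<omega>. indicator {v} (d i (\<tau> \<omega>)) * h v \<partial>M)"
      "integrable M (\<lambda>\<omega>. indicator {v} (d i (\<tau> \<omega>)) * f (X v \<omega>))"
      "integrable M (\<lambda>\<omega>. indicator {v} (d i (\<tau> \<omega>)) * h v)"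
      if "v \<in> range (d i)" for v
    proof -
      have v: "0 \<le> v" using that d(1) by auto
      note X[OF v, measurable]
      let ?I = "\<lambda>s. indicator {v} (d i s) :: complex"
      have I[measurable]: "?I \<in> borel_measurable borel" using d(3)[of i] by measurable
      have "indep_var borel (f \<circ> X v) borel (?I \<circ> \<tau>)"
        by (rule indep_var_compose[OF indep[OF v]]) measurable
      then have iv: "indep_var borel (\<lambda>\<omega>. f (X v \<omega>)) borel (\<lambda>\<omega>. ?I (\<tau> \<omega>))"
        by (simp add: comp_def)
      have iI: "integrable M (\<lambda>\<omega>. ?I (\<tau> \<omega>))"
        using measurable_compose[OF \<tau> I]
        by (intro integrable_const_bound[of _ 1]) (auto simp: indicator_def)
      show "(\<integral>\<omega>. ?I (\<tau> \<omega>) * f (X v \<omega>) \<partial>M) = (\<integral>\<omega>. ?I (\<tau> \<omega>) * h v \<partial>M)"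
        using indep_var_lebesgue_integral[OF iv int[OF v] iI] by (simp add: h_def mult.commute)
      show "integrable M (\<lambda>\<omega>. ?I (\<tau> \<omega>) * f (X v \<omega>))"
        using indep_var_integrable[OF iv int[OF v] iI] by (simp add: mult.commute)
      show "integrable M (\<lambda>\<omega>. ?I (\<tau> \<omega>) * h v)" using iI by simp
    qed
    have "(\<lambda>\<omega>. f (X (d i (\<tau> \<omega>)) \<omega>)) = (\<lambda>\<omega>. \<Sum>v\<in>range (d i). indicator {v} (d i (\<tau> \<omega>)) * f (X v \<omega>))"
      using d(2)[of i] by (auto simp: fun_eq_iff indicator_def if_distrib sum.If_cases Int_absorb2 cong: if_cong)
    then show ?thesis
      unfolding h_step by (simp add: Bochner_Integration.integral_sum ind)
  qed
  have h_\<tau>: "(\<lambda>\<omega>. h (\<tau> \<omega>)) \<in> borel_measurable M"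
    by (rule borel_measurable_LIMSEQ_metric[where f = "\<lambda>i \<omega>. h (d i (\<tau> \<omega>))"])
      (auto intro!: h_lim d_lim d(1) nonneg)
  have "(\<lambda>i. \<integral>\<omega>. f (X (d i (\<tau> \<omega>)) \<omega>) \<partial>M) \<longlonglongrightarrow> (\<integral>\<omega>. f (X (\<tau> \<omega>) \<omega>) \<partial>M)"
    by (rule integral_dominated_convergence[where w = "\<lambda>_. B"])
      (auto intro!: AE_I2 f_lim path_lim d_lim d(1) nonneg B)
  moreover have "(\<lambda>i. \<integral>\<omega>. h (d i (\<tau> \<omega>)) \<partial>M) \<longlonglongrightarrow> (\<integral>\<omega>. h (\<tau> \<omega>) \<partial>M)"
    by (rule integral_dominated_convergence[where w = "\<lambda>_. B"])
      (auto intro!: AE_I2 h_\<tau> h_lim d_lim d(1) nonneg h_bound)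
  ultimately show "(\<integral>\<omega>. f (X (\<tau> \<omega>) \<omega>) \<partial>M) = (\<integral>\<omega>. (\<integral>\<omega>'. f (X (\<tau> \<omega>) \<omega>') \<partial>M) \<partial>M)"
    unfolding step h_def by (rule LIMSEQ_unique)
qed

text \<open>Characteristic functions are compared. Conditioning on \<open>\<tau>\<close> and using
  the density at each fixed time gives an average of Fourier integrals; Fubini turns it into the
  Fourier integral of the averaged density, and Levy uniqueness identifies the laws.\<close>

lemma distributed_independent_time:
  fixes X :: "real \<Rightarrow> 'a \<Rightarrow> real" and \<tau> :: "'a \<Rightarrow> real" and g :: "real \<Rightarrow> real \<Rightarrow> real"
  assumes cont: "\<And>\<omega>. \<omega> \<in> space M \<Longrightarrow> continuous_on {0..} (\<lambda>s. X s \<omega>)"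
    and indep: "\<And>s. 0 \<le> s \<Longrightarrow> indep_var borel (X s) borel \<tau>"
    and nonneg: "\<And>\<omega>. \<omega> \<in> space M \<Longrightarrow> 0 \<le> \<tau> \<omega>"
    and pos: "AE \<omega> in M. 0 < \<tau> \<omega>"
    and g_distributed: "\<And>s. 0 < s \<Longrightarrow> distributed M lborel (X s) (\<lambda>x. ennreal (g s x))"
    and g_nonneg: "\<And>s x. 0 \<le> g s x"
    and g_measurable: "case_prod g \<in> borel_measurable (borel \<Otimes>\<^sub>M borel)"
    and g_integrable: "\<And>x. integrable M (\<lambda>\<omega>. g (\<tau> \<omega>) x)"
  shows "distributed M lborel (\<lambda>\<omega>. X (\<tau> \<omega>) \<omega>) (\<lambda>x. ennreal (\<integral>\<omega>. g (\<tau> \<omega>) x \<partial>M))"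
proof -
  interpret L: pair_sigma_finite M lborel ..
  let ?Y = "\<lambda>\<omega>. X (\<tau> \<omega>) \<omega>"
  define r where "r x = (\<integral>\<omega>. g (\<tau> \<omega>) x \<partial>M)" for x
  have \<tau>[measurable]: "\<tau> \<in> borel_measurable M"
    using indep_var_rv2[OF indep[of 0]] by simp
  have Y[measurable]: "?Y \<in> borel_measurable M"
    by (rule borel_measurable_independent_time[OF cont indep nonneg])
  note g_measurable[measurable]
  have gs[measurable]: "g s \<in> borel_measurable borel" for s
    using measurable_compose[OF measurable_Pair[OF measurable_const[of s borel] measurable_ident] g_measurable]
    by (simp add: comp_def)
  have G[measurable]: "(\<lambda>(\<omega>, x). g (\<tau> \<omega>) x) \<in> borel_measurable (M \<Otimes>\<^sub>M lborel)"
    using measurable_compose[OF _ g_measurable, of "\<lambda>p. (\<tau> (fst p), snd p)" "M \<Otimes>\<^sub>M lborel"]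
    by (simp add: split_beta')
  have r_nonneg: "0 \<le> r x" for x unfolding r_def by (intro Bochner_Integration.integral_nonneg g_nonneg)
  have r[measurable]: "r \<in> borel_measurable borel"
  proof -
    have "(\<lambda>(x, \<omega>). g (\<tau> \<omega>) x) \<in> borel_measurable (lborel \<Otimes>\<^sub>M M)"
      using measurable_compose[OF _ g_measurable, of "\<lambda>p. (\<tau> (snd p), fst p)" "lborel \<Otimes>\<^sub>M M"]
      by (simp add: split_beta')
    then have "(\<lambda>x. \<integral>\<omega>. g (\<tau> \<omega>) x \<partial>M) \<in> borel_measurable lborel"
      by (rule borel_measurable_lebesgue_integral)
    then show ?thesis unfolding r_def[abs_def] by simp
  qed
  have g_nn: "(\<integral>\<^sup>+x. g s x \<partial>lborel) = 1" if "0 < s" for s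
    using distributed_nn_integral[OF g_distributed[OF that], of "\<lambda>_. 1"] by (simp add: emeasure_space_1)
  \<comment> \<open>Levy uniqueness compares probability laws, so the averaged density must have
    total mass one; this is Tonelli.\<close>
  have r_nn: "(\<integral>\<^sup>+x. r x \<partial>lborel) = 1"
  proof -
    have "(\<integral>\<^sup>+x. r x \<partial>lborel) = (\<integral>\<^sup>+x. (\<integral>\<^sup>+\<omega>. g (\<tau> \<omega>) x \<partial>M) \<partial>lborel)"
      by (simp add: r_def nn_integral_eq_integral g_integrable g_nonneg)
    also have "\<dots> = (\<integral>\<^sup>+\<omega>. (\<integral>\<^sup>+x. g (\<tau> \<omega>) x \<partial>lborel) \<partial>M)"
      using L.Fubini'[of "\<lambda>\<omega> x. ennreal (g (\<tau> \<omega>) x)"] by simp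
    also have "\<dots> = (\<integral>\<^sup>+\<omega>. 1 \<partial>M)"
      using pos by (intro nn_integral_cong_AE) (auto simp: g_nn)
    finally show ?thesis by (simp add: emeasure_space_1)
  qed
  have "distr M borel ?Y = density lborel r"
  proof (rule Levy_uniqueness)
    show "real_distribution (distr M borel ?Y)"
      by (simp add: real_distribution_def real_distribution_axioms_def prob_space_distr)
    show "real_distribution (density lborel r)"
      unfolding real_distribution_def real_distribution_axioms_def
      by (auto intro!: prob_spaceI simp: emeasure_density r_nn)
    show "char (distr M borel ?Y) = char (density lborel r)"
    proof
      fix u
      let ?e = "\<lambda>x. iexp (u * x)"
      have e[measurable]: "?e \<in> borel_measurable borel"
        by (intro borel_measurable_continuous_onI continuous_intros)
      have inner: "(\<integral>\<omega>. ?e (X s \<omega>) \<partial>M) = (\<integral>x. g s x *\<^sub>R ?e x \<partial>lborel)" if "0 < s" for s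
      proof -
        have [measurable]: "X s \<in> borel_measurable M"
          using indep_var_rv1[OF indep[of s]] that by simp
        have "(\<integral>\<omega>. ?e (X s \<omega>) \<partial>M) = (\<integral>x. ?e x \<partial>distr M lborel (X s))"
          by (rule integral_distr[symmetric]) auto
        also have "\<dots> = (\<integral>x. g s x *\<^sub>R ?e x \<partial>lborel)"
          unfolding distributed_distr_eq_density[OF g_distributed[OF that]]
          by (rule integral_density) (auto simp: g_nonneg)
        finally show ?thesis .
      qed
      \<comment> \<open>The exponential has modulus 1, so the integral of the norm is the total mass
        of the averaged densities.\<close>
      have G_int: "integrable (M \<Otimes>\<^sub>M lborel) (\<lambda>(\<omega>, x). g (\<tau> \<omega>) x *\<^sub>R ?e x)"
      proof (rule integrableI_bounded)
        have "(\<integral>\<^sup>+p. norm ((\<lambda>(\<omega>, x). g (\<tau> \<omega>) x *\<^sub>R ?e x) p) \<partial>(M \<Otimes>\<^sub>M lborel)) =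
            (\<integral>\<^sup>+p. ennreal (g (\<tau> (fst p)) (snd p)) \<partial>(M \<Otimes>\<^sub>M lborel))"
          by (intro nn_integral_cong) (auto simp: g_nonneg)
        also have "\<dots> = (\<integral>\<^sup>+\<omega>. (\<integral>\<^sup>+x. g (\<tau> \<omega>) x \<partial>lborel) \<partial>M)"
          using lborel.nn_integral_fst[of "\<lambda>p. ennreal (g (\<tau> (fst p)) (snd p))" M] G
          by (simp add: split_beta')
        also have "\<dots> = (\<integral>\<^sup>+\<omega>. 1 \<partial>M)"
          using pos by (intro nn_integral_cong_AE) (auto simp: g_nn)
        finally show "(\<integral>\<^sup>+p. norm ((\<lambda>(\<omega>, x). g (\<tau> \<omega>) x *\<^sub>R ?e x) p) \<partial>(M \<Otimes>\<^sub>M lborel)) < \<infinity>"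
          by (simp add: emeasure_space_1)
      qed (use G in \<open>simp add: split_beta'\<close>)
      have "char (distr M borel ?Y) u = (\<integral>\<omega>. ?e (?Y \<omega>) \<partial>M)"
        unfolding char_def by (rule integral_distr) auto
      also have "\<dots> = (\<integral>\<omega>. (\<integral>\<omega>'. ?e (X (\<tau> \<omega>) \<omega>') \<partial>M) \<partial>M)"
        by (rule integral_independent_time[OF cont indep nonneg])
          (auto intro!: continuous_intros boundedI[of _ 1])
      also have "\<dots> = (\<integral>\<omega>. (\<integral>x. g (\<tau> \<omega>) x *\<^sub>R ?e x \<partial>lborel) \<partial>M)"
        proof (rule integral_cong_AE)
          let ?h = "\<lambda>s. \<integral>\<omega>'. ?e (X s \<omega>') \<partial>M"
          let ?k = "\<lambda>\<omega>. \<integral>x. g (\<tau> \<omega>) x *\<^sub>R ?e x \<partial>lborel"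
          show k[measurable]: "?k \<in> borel_measurable M"
            using G_int[THEN borel_measurable_integrable] by (rule lborel.borel_measurable_lebesgue_integral)
          \<comment> \<open>No density is assumed at time 0, and \<open>X 0\<close> may be constant.
            Treating \<open>\<tau> \<omega> = 0\<close> separately yields measurability of
            \<open>?h (\<tau> \<omega>)\<close>; the event is null and does not affect the
            integral.\<close>
          have "(\<lambda>\<omega>. if \<tau> \<omega> = 0 then ?h 0 else ?k \<omega>) \<in> borel_measurable M"
            by measurable
          moreover have "?h (\<tau> \<omega>) = (if \<tau> \<omega> = 0 then ?h 0 else ?k \<omega>)" if "\<omega> \<in> space M" for \<omega>
            using inner[of "\<tau> \<omega>"] nonneg[OF that] by auto
          ultimately show "(\<lambda>\<omega>. ?h (\<tau> \<omega>)) \<in> borel_measurable M"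
            by (subst measurable_cong)
          show "AE \<omega> in M. ?h (\<tau> \<omega>) = ?k \<omega>"
            using pos by eventually_elim (rule inner)
        qed
      also have "\<dots> = (\<integral>x. (\<integral>\<omega>. g (\<tau> \<omega>) x *\<^sub>R ?e x \<partial>M) \<partial>lborel)"
        by (rule L.Fubini_integral[OF G_int, symmetric])
      also have "\<dots> = (\<integral>x. r x *\<^sub>R ?e x \<partial>lborel)"
        by (simp only: r_def integral_scaleR_left[OF g_integrable])
      also have "\<dots> = char (density lborel r) u"
        unfolding char_def by (rule integral_density[symmetric]) (auto simp: r_nonneg)
      finally show "char (distr M borel ?Y) u = char (density lborel r) u" .
    qed
  qed
  moreover have "distr M lborel ?Y = distr M borel ?Y" by (rule distr_cong) auto
  ultimately show ?thesis
    unfolding distributed_def r_def[symmetric] by auto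
qed

end

section \<open>One-dimensional laws of fractional Brownian motion\<close>

text \<open>The linear combination over the singleton \<open>{s}\<close> is Gaussian in the wide
  sense; mean 0 and second moment s^(2H) then fix its parameters.\<close>

lemma fractional_brownian_motion_distributed:
  assumes B: "fractional_brownian_motion M T H B" and s: "s \<in> T" "0 < s"
  shows "distributed M lborel (B s) (normal_density 0 (s powr H))"
proof -
  from B have "prob_space M" "gaussian_process M T B" "centred_process M T B"
    unfolding fractional_brownian_motion_def gaussian_process_def by auto
  interpret prob_space M by fact
  have mean: "expectation (B s) = 0"
    using \<open>centred_process M T B\<close> s(1) by (simp add: centred_process_def)
  have second_moment: "expectation (\<lambda>\<omega>. B s \<omega> * B s \<omega>) = (s powr H)\<^sup>2"
  proof -
    have "expectation (\<lambda>\<omega>. B s \<omega> * B s \<omega>) =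
        1 / 2 * (\<bar>s\<bar> powr (2 * H) + \<bar>s\<bar> powr (2 * H) - \<bar>s - s\<bar> powr (2 * H))"
      using B s(1) unfolding fractional_brownian_motion_def by blast
    also have "\<dots> = s powr (H + H)" using s(2) by simp
    finally show ?thesis by (simp only: powr_add power2_eq_square)
  qed
  have "gaussian_variable M (\<lambda>\<omega>. \<Sum>t\<in>{s}. 1 * B t \<omega>)"
    using \<open>gaussian_process M T B\<close> s(1) unfolding gaussian_process_def
    by (elim conjE allE[of _ "{s}"] allE[of _ "\<lambda>_. 1"]) auto
  then have meas[measurable]: "B s \<in> borel_measurable M"
    and "\<exists>\<mu> \<sigma>. 0 < \<sigma> \<and> distributed M lborel (B s) (normal_density \<mu> \<sigma>) \<or> (AE \<omega> in M. B s \<omega> = \<mu>)"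
    by (simp_all add: gaussian_variable_def)
  then obtain \<mu> \<sigma> where
    "0 < \<sigma> \<and> distributed M lborel (B s) (normal_density \<mu> \<sigma>) \<or> (AE \<omega> in M. B s \<omega> = \<mu>)"
    by blast
  then show ?thesis
  proof
    assume *: "0 < \<sigma> \<and> distributed M lborel (B s) (normal_density \<mu> \<sigma>)"
    then have \<mu>: "\<mu> = 0" using normal_distributed_expectation[of \<sigma> "B s" \<mu>] mean by simp
    have "variance (B s) = \<sigma>\<^sup>2" using * normal_distributed_variance[of \<sigma> "B s" \<mu>] by simp
    then have "\<sigma>\<^sup>2 = (s powr H)\<^sup>2" using mean second_moment by (simp add: power2_eq_square)
    then have "\<sigma> = s powr H" using * by (simp add: power2_eq_iff_nonneg)
    then show ?thesis using * \<mu> by simp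
  next
    \<comment> \<open>Degeneracy is impossible: mean 0 would force the constant to be 0, against the
      positive second moment.\<close>
    assume const: "AE \<omega> in M. B s \<omega> = \<mu>"
    then have "expectation (B s) = (\<integral>\<omega>. \<mu> \<partial>M)" by (intro integral_cong_AE) auto
    then have "\<mu> = 0" using mean by (simp add: prob_space)
    then have "expectation (\<lambda>\<omega>. B s \<omega> * B s \<omega>) = (\<integral>\<omega>. 0 \<partial>M)"
      using const by (intro integral_cong_AE) auto
    then show ?thesis using second_moment s(2) by simp
  qed
qed

subsection \<open>The density of iterated fractional Brownian motion\<close>

lemma normal_density_scale:
  assumes "0 < c"
  shows "normal_density 0 (c * \<sigma>) x = normal_density 0 \<sigma> (x / c) / c"
proof -
  have "sqrt (2 * pi * (c * \<sigma>)\<^sup>2) = c * sqrt (2 * pi * \<sigma>\<^sup>2)"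
    using assms by (simp add: power_mult_distrib real_sqrt_mult)
  then show ?thesis
    using assms by (simp add: normal_density_def power_mult_distrib power_divide mult.commute)
qed

lemma
  fixes F :: "real \<Rightarrow> real"
  assumes c: "0 < c"
  shows integral_normal_density_scale:
      "(\<integral>u. normal_density 0 c u * F u \<partial>lborel) = (\<integral>u. std_normal_density u * F (c * u) \<partial>lborel)"
    and integrable_normal_density_scale_iff:
      "integrable lborel (\<lambda>u. normal_density 0 c u * F u) \<longleftrightarrow>
       integrable lborel (\<lambda>u. std_normal_density u * F (c * u))"
proof -
  have eq: "normal_density 0 c (0 + c * u) * F (0 + c * u) = inverse c * (std_normal_density u * F (c * u))" for u
  proof -
    have "normal_density 0 c (c * u) = std_normal_density u / c"
      using normal_density_scale[OF c, of 1 "c * u"] c by simp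
    then show ?thesis by (simp add: divide_inverse)
  qed
  show "(\<integral>u. normal_density 0 c u * F u \<partial>lborel) = (\<integral>u. std_normal_density u * F (c * u) \<partial>lborel)"
    by (subst lborel_integral_real_affine[of c _ 0]) (use c in \<open>simp_all only: eq\<close>, simp)
  show "integrable lborel (\<lambda>u. normal_density 0 c u * F u) \<longleftrightarrow>
       integrable lborel (\<lambda>u. std_normal_density u * F (c * u))"
    using lborel_integrable_real_affine_iff[of c "\<lambda>u. normal_density 0 c u * F u" 0] c
    unfolding eq by (simp add: integrable_mult_right_iff)
qed

text \<open>The conditional standard deviation of the iterated process, expressed through a standard
  normal \<open>u\<close> with \<open>B2 t\<close> distributed as \<open>t powr H2 * u\<close>. The
  mixing measure thus is the same for all times.\<close>

definition iterated_scale :: "real \<Rightarrow> real \<Rightarrow> real \<Rightarrow> real \<Rightarrow> real" where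
  "iterated_scale H1 H2 t u = \<bar>t powr H2 * u\<bar> powr H1"

lemma iterated_scale_eq:
  "0 < t \<Longrightarrow> iterated_scale H1 H2 t u = t powr (H1 * H2) * iterated_scale H1 H2 1 u"
  by (simp add: iterated_scale_def abs_mult powr_mult powr_powr mult.commute)

lemma borel_measurable_iterated_scale[measurable]: "iterated_scale H1 H2 t \<in> borel_measurable borel"
  unfolding iterated_scale_def[abs_def] by measurable

text \<open>Up to a factor depending on t, this is the moment of order - k H1 of a standard normal
  variable. The case \<open>k = 1\<close> gives smoothness away from 0, the case
  \<open>k = 3\<close> gives it at 0.\<close>

lemma integrable_inverse_iterated_scale:
  assumes "0 < t" "0 < H1" "real k * H1 < 1" "0 < k"
  shows "integrable std_normal_distribution (\<lambda>u. 1 / \<bar>iterated_scale H1 H2 t u\<bar> ^ k)"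
proof -
  \<comment> \<open>At \<open>u = 0\<close> both sides are 0, because \<open>0 powr h = 0\<close>
    and \<open>k\<close> is positive.\<close>
  have "(\<bar>u\<bar> powr H1) ^ k = \<bar>u\<bar> powr (real k * H1)" for u
    using assms(4) powr_power[of "\<bar>u\<bar>" H1 k] by (cases "u = 0") simp_all
  then have "std_normal_density u *\<^sub>R (1 / \<bar>iterated_scale H1 H2 t u\<bar> ^ k) =
      1 / (t powr (H1 * H2)) ^ k * (std_normal_density u * \<bar>u\<bar> powr - (real k * H1))" for u
    unfolding iterated_scale_eq[OF assms(1)]
    by (simp add: iterated_scale_def power_mult_distrib powr_minus_divide)
  moreover have "integrable lborel (\<lambda>u. std_normal_density u * \<bar>u\<bar> powr - (real k * H1))"
    using assms by (intro integrable_powr_std_normal_density) auto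
  ultimately show ?thesis
    by (subst integrable_density) simp_all
qed

lemma normal_scale_mixture_iterated:
  assumes "0 < t" "0 < H1" "H1 < 1"
  shows "normal_scale_mixture std_normal_distribution (iterated_scale H1 H2 t)"
  using integrable_inverse_iterated_scale[of t H1 1 H2] assms
  by unfold_locales simp_all

text \<open>Substituting \<open>t powr H2 * u\<close> replaces the standard normal variable by one
  with the law of \<open>B2 t\<close>. This form is compared both with the defining integral of the
  density and with an expectation over \<open>B2 t\<close>.\<close>

lemma mixture_iterated_scale:
  assumes "0 < t" "0 < H1" "H1 < 1"
  shows "normal_scale_mixture.mixture std_normal_distribution (iterated_scale H1 H2 t) x =
      (\<integral>u. normal_density 0 (t powr H2) u * normal_density 0 (\<bar>u\<bar> powr H1) x \<partial>lborel)"
    "integrable lborel (\<lambda>u. normal_density 0 (t powr H2) u * normal_density 0 (\<bar>u\<bar> powr H1) x)"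
proof -
  interpret normal_scale_mixture std_normal_distribution "iterated_scale H1 H2 t"
    using assms by (rule normal_scale_mixture_iterated)
  have c: "0 < t powr H2" using assms by simp
  have [measurable]: "(\<lambda>u. normal_density 0 (iterated_scale H1 H2 t u) x) \<in> borel_measurable borel"
    unfolding normal_density_def by measurable
  have "mixture x = (\<integral>u. std_normal_density u *\<^sub>R normal_density 0 (iterated_scale H1 H2 t u) x \<partial>lborel)"
    unfolding mixture_def by (rule integral_density) simp_all
  then show "mixture x = (\<integral>u. normal_density 0 (t powr H2) u * normal_density 0 (\<bar>u\<bar> powr H1) x \<partial>lborel)"
    unfolding integral_normal_density_scale[OF c] iterated_scale_def real_scaleR_def .
  have "integrable lborel (\<lambda>u. std_normal_density u * normal_density 0 (iterated_scale H1 H2 t u) x)"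
    using integrable_normal_density_scale[of x] by (subst (asm) integrable_density) simp_all
  then show "integrable lborel (\<lambda>u. normal_density 0 (t powr H2) u * normal_density 0 (\<bar>u\<bar> powr H1) x)"
    unfolding integrable_normal_density_scale_iff[OF c] iterated_scale_def .
qed

text \<open>The integrand is even in u, so folding the real line onto the half-line produces the
  factor 2.\<close>

lemma iterated_fbm_density_eq_mixture:
  assumes "0 < t" "0 < H1" "H1 < 1"
  shows "iterated_fbm_density H1 H2 x t =
    normal_scale_mixture.mixture std_normal_distribution (iterated_scale H1 H2 t) x"
proof -
  let ?F = "\<lambda>u. normal_density 0 (t powr H2) u * normal_density 0 (\<bar>u\<bar> powr H1) x"
  have half: "integrable lborel (\<lambda>u. indicator {0..} u *\<^sub>R ?F u)"
    by (intro integrable_mult_indicator mixture_iterated_scale(2)[OF assms]) simp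
  have even: "?F (- u) = ?F u" for u by (simp add: normal_density_def)
  have "normal_scale_mixture.mixture std_normal_distribution (iterated_scale H1 H2 t) x =
      2 *\<^sub>R (\<integral>u. indicator {0..} u *\<^sub>R ?F u \<partial>lborel)"
    unfolding mixture_iterated_scale(1)[OF assms]
    by (rule has_bochner_integral_integral_eq[OF
          has_bochner_integral_even_function[OF has_bochner_integral_integrable[OF half] even]])
  also have "(\<lambda>u. indicator {0..} u *\<^sub>R ?F u) = (\<lambda>s. indicator {0<..} s *\<^sub>R
      (exp (- (x\<^sup>2 / (2 * s powr (2 * H1)))) / sqrt (2 * pi * s powr (2 * H1)) *
       (exp (- (s\<^sup>2 / (2 * t powr (2 * H2)))) / sqrt (2 * pi * t powr (2 * H2)))))"
  proof
    fix s
    have sq: "(y powr h)\<^sup>2 = y powr (2 * h)" for y h :: real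
      by (simp add: power2_eq_square flip: powr_add)
    show "indicator {0..} s *\<^sub>R ?F s = indicator {0<..} s *\<^sub>R
      (exp (- (x\<^sup>2 / (2 * s powr (2 * H1)))) / sqrt (2 * pi * s powr (2 * H1)) *
       (exp (- (s\<^sup>2 / (2 * t powr (2 * H2)))) / sqrt (2 * pi * t powr (2 * H2))))"
      \<comment> \<open>The half-lines differ at \<open>s = 0\<close> only, where
        \<open>normal_density 0 0 x\<close> is 0 through division by zero.\<close>
      by (cases "0 < s"; cases "s = 0") (simp_all add: normal_density_def sq mult.commute)
  qed
  finally show ?thesis
    by (simp add: iterated_fbm_density_def set_lebesgue_integral_def)
qed

text \<open>The scale at time t is \<open>t powr (H1 * H2)\<close> times the scale at time 1, and a
  normal density of rescaled deviation is a rescaled normal density. The profile is therefore the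
  mixture at time 1.\<close>

lemma iterated_fbm_density_self_similar:
  assumes "0 < t" "0 < H1" "H1 < 1"
  shows "iterated_fbm_density H1 H2 x t = t powr - (H1 * H2) *
    normal_scale_mixture.mixture std_normal_distribution (iterated_scale H1 H2 1) (x * t powr - (H1 * H2))"
proof -
  interpret S: normal_scale_mixture std_normal_distribution "iterated_scale H1 H2 1"
    using assms by (intro normal_scale_mixture_iterated) auto
  interpret normal_scale_mixture std_normal_distribution "iterated_scale H1 H2 t"
    using assms by (rule normal_scale_mixture_iterated)
  have "mixture x = (\<integral>u. normal_density 0 (iterated_scale H1 H2 1 u) (x / t powr (H1 * H2)) / t powr (H1 * H2)
      \<partial>std_normal_distribution)"
    unfolding mixture_def iterated_scale_eq[OF assms(1)]
    using assms by (simp add: normal_density_scale)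
  then show ?thesis
    unfolding iterated_fbm_density_eq_mixture[OF assms]
    by (simp add: S.mixture_def powr_minus divide_inverse mult.commute)
qed

theorem theorem2p5:
  fixes M :: "'a measure" and T :: "real set" and H1 H2 :: real
    and B1 B2 :: "real \<Rightarrow> 'a \<Rightarrow> real"
  defines "p \<equiv> iterated_fbm_density H1 H2"
  assumes "0 < H1" "H1 < 1" "0 < H2" "H2 < 1"
    and "prob_space M"
    and "{0..} \<subseteq> T"
    and "fractional_brownian_motion M T H1 B1"
    and "fractional_brownian_motion M T H2 B2"
    and "independent_processes M T B1 B2"
    and "\<And>\<omega>. \<omega> \<in> space M \<Longrightarrow> continuous_on {0..} (\<lambda>s. B1 s \<omega>)"
  shows "(\<forall>t>0. distributed M lborel (iterated_process B1 B2 t) (\<lambda>x. ennreal (p x t))) \<and>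
    (\<forall>x. \<forall>t>0.
       twice_differentiable_at (\<lambda>\<tau>. p x \<tau>) t \<and>
       (x \<noteq> 0 \<or> H1 < 1 / 3 \<longrightarrow> twice_differentiable_at (\<lambda>\<xi>. p \<xi> t) x) \<and>
       (1 + H1 * H2) * t * deriv (\<lambda>\<tau>. p x \<tau>) t + t\<^sup>2 * deriv (deriv (\<lambda>\<tau>. p x \<tau>)) t =
         H1\<^sup>2 * H2\<^sup>2 *
           (2 * x * deriv (\<lambda>\<xi>. p \<xi> t) x + x\<^sup>2 * deriv (deriv (\<lambda>\<xi>. p \<xi> t)) x)) \<and>
    (\<forall>t>0.
       ((\<lambda>x. x * deriv (\<lambda>\<xi>. p \<xi> t) x) \<longlongrightarrow> 0) (at 0) \<and>
       ((\<lambda>x. x\<^sup>2 * deriv (deriv (\<lambda>\<xi>. p \<xi> t)) x) \<longlongrightarrow> 0) (at 0))"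
proof (intro conjI allI impI)
  interpret prob_space M by fact
  note H1 = \<open>0 < H1\<close> \<open>H1 < 1\<close>
  interpret S: normal_scale_mixture std_normal_distribution "iterated_scale H1 H2 1"
    using H1 by (intro normal_scale_mixture_iterated) auto
  fix t :: real assume t: "0 < t"
  interpret normal_scale_mixture std_normal_distribution "iterated_scale H1 H2 t"
    using t H1 by (rule normal_scale_mixture_iterated)
  have p_mixture: "(\<lambda>\<xi>. p \<xi> t) = mixture"
    using iterated_fbm_density_eq_mixture[OF t H1] by (simp add: p_def fun_eq_iff)
  have self_similar: "p x s = s powr - (H1 * H2) * S.mixture (x * s powr - (H1 * H2))" if "0 < s" for x s
    unfolding p_def using that H1 by (rule iterated_fbm_density_self_similar)
  note pde = self_similar_pde[OF self_similar, where \<phi>' = S.mixture_deriv and \<phi>'' = S.mixture_deriv2]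
  show "twice_differentiable_at (\<lambda>\<tau>. p x \<tau>) t" for x
    by (rule pde) (auto intro: S.has_real_derivative_mixture t)
  show "(1 + H1 * H2) * t * deriv (\<lambda>\<tau>. p x \<tau>) t + t\<^sup>2 * deriv (deriv (\<lambda>\<tau>. p x \<tau>)) t =
      H1\<^sup>2 * H2\<^sup>2 * (2 * x * deriv (\<lambda>\<xi>. p \<xi> t) x + x\<^sup>2 * deriv (deriv (\<lambda>\<xi>. p \<xi> t)) x)" for x
    unfolding power_mult_distrib[symmetric]
    by (rule pde) (auto intro: S.has_real_derivative_mixture t)
  show "twice_differentiable_at (\<lambda>\<xi>. p \<xi> t) x" if "x \<noteq> 0 \<or> H1 < 1 / 3" for x
    \<comment> \<open>At the origin the third inverse moment is required; it is finite because 3 H1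
      < 1.\<close>
    unfolding p_mixture using that integrable_inverse_iterated_scale[OF t H1(1), of 3 H2]
    by (intro mixture_derivs(1)) auto
  show "((\<lambda>x. x * deriv (\<lambda>\<xi>. p \<xi> t) x) \<longlongrightarrow> 0) (at 0)"
    "((\<lambda>x. x\<^sup>2 * deriv (deriv (\<lambda>\<xi>. p \<xi> t)) x) \<longlongrightarrow> 0) (at 0)"
    unfolding p_mixture by (rule mixture_limits)+
  let ?\<tau> = "\<lambda>\<omega>. \<bar>B2 t \<omega>\<bar>"
  have T: "s \<in> T" if "0 \<le> s" for s
    using \<open>{0..} \<subseteq> T\<close> that by auto
  have B2: "distributed M lborel (B2 t) (normal_density 0 (t powr H2))"
    by (rule fractional_brownian_motion_distributed[OF assms(9)]) (use T t in auto)
  have meas: "(\<lambda>u. normal_density 0 (\<bar>u\<bar> powr H1) x) \<in> borel_measurable lborel" for x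
    unfolding normal_density_def by measurable
  have "distributed M lborel (\<lambda>\<omega>. B1 (?\<tau> \<omega>) \<omega>)
      (\<lambda>x. ennreal (\<integral>\<omega>. normal_density 0 (?\<tau> \<omega> powr H1) x \<partial>M))"
  proof (rule distributed_independent_time[where X = B1 and \<tau> = ?\<tau>
        and g = "\<lambda>s x. normal_density 0 (s powr H1) x"])
    show "continuous_on {0..} (\<lambda>s. B1 s \<omega>)" if "\<omega> \<in> space M" for \<omega>
      using that by (rule assms)
    show "indep_var borel (B1 s) borel ?\<tau>" if "0 \<le> s" for s
    proof -
      have st: "s \<in> T" "t \<in> T" using that t T by auto
      \<comment> \<open>Independence of the whole paths passes to measurable functionals of them:
        evaluation at \<open>s\<close>, and the absolute value of evaluation at
        \<open>t\<close>.\<close>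
      have "indep_var borel ((\<lambda>f. f s) \<circ> (\<lambda>\<omega>. \<lambda>t\<in>T. B1 t \<omega>)) borel ((\<lambda>f. \<bar>f t\<bar>) \<circ> (\<lambda>\<omega>. \<lambda>t\<in>T. B2 t \<omega>))"
        using assms(10) st unfolding independent_processes_def
        by (intro indep_var_compose) (auto intro!: measurable_component_singleton borel_measurable_abs)
      then show ?thesis using st by (simp add: comp_def)
    qed
    show "AE \<omega> in M. 0 < ?\<tau> \<omega>"
    proof -
      \<comment> \<open>The law of \<open>B2 t\<close> has a density, so it puts no mass on 0 and
        the random time is almost surely positive.\<close>
      have "AE u in distr M lborel (B2 t). u \<noteq> 0"
        unfolding distributed_distr_eq_density[OF B2]
        using AE_lborel_singleton[of 0] by (subst AE_density) auto
      then have "AE \<omega> in M. B2 t \<omega> \<noteq> 0"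
        using distributed_measurable[OF B2] by (subst (asm) AE_distr_iff) auto
      then show ?thesis by eventually_elim simp
    qed
    show "distributed M lborel (B1 s) (\<lambda>x. ennreal (normal_density 0 (s powr H1) x))" if "0 < s" for s
      by (rule fractional_brownian_motion_distributed[OF assms(8)]) (use T that in auto)
    show "case_prod (\<lambda>s. normal_density 0 (s powr H1)) \<in> borel_measurable (borel \<Otimes>\<^sub>M borel)"
      unfolding normal_density_def by measurable
    show "integrable M (\<lambda>\<omega>. normal_density 0 (?\<tau> \<omega> powr H1) x)" for x
      using mixture_iterated_scale(2)[OF t H1] distributed_integrable[OF B2 meas] by simp
  qed auto
  moreover have "(\<integral>\<omega>. normal_density 0 (?\<tau> \<omega> powr H1) x \<partial>M) = p x t" for x
    using distributed_integral[OF B2 meas] mixture_iterated_scale(1)[OF t H1]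
      iterated_fbm_density_eq_mixture[OF t H1] by (simp add: p_def)
  ultimately show "distributed M lborel (iterated_process B1 B2 t) (\<lambda>x. ennreal (p x t))"
    by (simp add: iterated_process_def[abs_def])
qed

end
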